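(* Let $d\ge1$, let $n$ be an even positive integer, and let $D$ be the uniform distribution on all $x\in\{\pm1\}^n$ with $\sum_{i=1}^n x_i=0$. For every multilinear polynomial $g$ in $x_1,\dots,x_n$ of degree at most $d$, $$\mathbb E_{D}[g^4]\le 12\,d\cdot 9^{2d}\cdot\big(\mathbb E_D[g^2]\big)^2 .$$
   Context: Polynomials have real coefficients. *)

theory Defs
  imports "HOL-Probability.Probability" "HOL-Library.Poly_Mapping"
begin

text \<open>
  A monomial is its finitely supported exponent vector; a real polynomial in the variables
  \<open>x\<^sub>0, x\<^sub>1, \<dots>\<close> is a finitely supported map from monomials to coefficients.
\<close>

type_synonym monomial = "nat \<Rightarrow>\<^sub>0 nat"
type_synonym real_mpoly = "monomial \<Rightarrow>\<^sub>0 real"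

definition mpoly_vars :: "real_mpoly \<Rightarrow> nat set" where
  "mpoly_vars p = (\<Union>m \<in> Poly_Mapping.keys p. Poly_Mapping.keys m)"

definition monomial_degree :: "monomial \<Rightarrow> nat" where
  "monomial_degree m = (\<Sum>i \<in> Poly_Mapping.keys m. Poly_Mapping.lookup m i)"

text \<open>Inserting 0 makes the zero polynomial have degree 0, hence degree at most \<open>d\<close> for every \<open>d\<close>.\<close>

definition total_degree :: "real_mpoly \<Rightarrow> nat" where
  "total_degree p = Max (insert 0 (monomial_degree ` Poly_Mapping.keys p))"

definition multilinear :: "real_mpoly \<Rightarrow> bool" where
  "multilinear p \<longleftrightarrow> (\<forall>m \<in> Poly_Mapping.keys p. \<forall>i. Poly_Mapping.lookup m i \<le> 1)"

definition mpoly_eval :: "real_mpoly \<Rightarrow> (nat \<Rightarrow> real) \<Rightarrow> real" where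
  "mpoly_eval p x =
     (\<Sum>m \<in> Poly_Mapping.keys p.
        Poly_Mapping.lookup p m * (\<Prod>i \<in> Poly_Mapping.keys m. x i ^ Poly_Mapping.lookup m i))"

text \<open>
  Points of \<open>{-1,1}\<^sup>n\<close> are functions on \<open>{1..n}\<close>, extended by \<open>undefined\<close> outside that set, so that
  each point is counted exactly once.
\<close>

definition balanced_slice :: "nat \<Rightarrow> (nat \<Rightarrow> real) set" where
  "balanced_slice n = {x \<in> {1..n} \<rightarrow>\<^sub>E {-1, 1}. (\<Sum>i = 1..n. x i) = 0}"

text \<open>
  For even \<open>n\<close> the slice is finite and nonempty, as \<open>pmf_of_set\<close> needs to be the uniform distribution.
\<close>

definition balanced_pmf :: "nat \<Rightarrow> (nat \<Rightarrow> real) pmf" where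
  "balanced_pmf n = pmf_of_set (balanced_slice n)"

end

(*
  Write E for the average over the cube {-1,1}^N and E_0 for the average over its middle slice, and
  say that g = sum_S g_S x^S is harmonic if sum_(i not in R) g_(R + i) = 0 for all R.

  Since sum_i x_i vanishes on the slice, multiplying it by a monomial x^R and reducing gives a
  relation between monomials of degrees |R| + 1 and |R| - 1.  Projecting the top level orthogonally
  to these relations, and repeating downwards, replaces any polynomial by a harmonic one of at most
  the same degree with the same values on the slice.

  For harmonic g, E[g^2] <= E_0[g^2].  Indeed E_0[x^S x^T] depends only on |S|, |T| and |S \<inter> T|;
  expanded in Newton's form over the subsets of S \<inter> T, all terms but the top one die against g.
  So different degrees are orthogonal under E_0, and g_S is multiplied within its degree by
  sum_j (-1)^j (|S| choose j) E_0[x_1 ... x_(2j)], whose terms are nonnegative and start with 1.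

  Conversely, let T be the noise operator that resamples each coordinate with probability 1/3.
  Resampling J coordinates of a uniform point of the slice gives a law with density at most
  v(J) / v(n) on the cube, v(j) = (j choose j/2) / 2^j, and averaging over J gives at most 3.  Hence
  E_0[(T h)^4] <= 3 E[h^4], and with g = T h, Bonami's inequality for h gives
  E_0[g^4] <= 3 (27/4)^(2d) (E[g^2])^2 <= 3 (27/4)^(2d) (E_0[g^2])^2.
*)
theory Submission
  imports Defs
begin

section \<open>Walsh polynomials on the cube\<close>

definition chi :: "'a set \<Rightarrow> 'a set \<Rightarrow> real" where
  "chi S A = (\<Prod>i\<in>S. if i \<in> A then 1 else - 1)"

text \<open>A subset \<open>A\<close> encodes the cube point equal to +1 on \<open>A\<close> and -1
  elsewhere, so \<open>chi S A\<close> is the monomial x^S at that point.\<close>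

definition walsh :: "'a set \<Rightarrow> ('a set \<Rightarrow> real) \<Rightarrow> 'a set \<Rightarrow> real" where
  "walsh N c A = (\<Sum>S\<in>Pow N. c S * chi S A)"

definition middle :: "'a set \<Rightarrow> 'a set set" where
  "middle N = {A \<in> Pow N. 2 * card A = card N}"

lemma chi_empty [simp]: "chi {} A = 1"
  by (simp add: chi_def)

lemma chi_insert:
  "finite S \<Longrightarrow> a \<notin> S \<Longrightarrow> chi (insert a S) A = (if a \<in> A then 1 else - 1) * chi S A"
  by (simp add: chi_def)

lemma chi_square: "chi S A * chi S A = 1"
  unfolding chi_def prod.distrib[symmetric] by (intro prod.neutral) auto

lemma chi_Un_disjoint:
  "finite S \<Longrightarrow> finite T \<Longrightarrow> S \<inter> T = {} \<Longrightarrow> chi (S \<union> T) A = chi S A * chi T A"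
  by (simp add: chi_def prod.union_disjoint)

lemma chi_mult:
  assumes "finite S" "finite T"
  shows "chi S A * chi T A = chi ((S - T) \<union> (T - S)) A"
proof -
  have "chi S A = chi (S - T) A * chi (S \<inter> T) A" if "finite S" for S T
    using that chi_Un_disjoint[of "S - T" "S \<inter> T" A] by (simp add: Un_Diff_Int Diff_Int_distrib2)
  from this[of S T] this[of T S] assms
  have "chi S A * chi T A = chi (S - T) A * chi (T - S) A * (chi (S \<inter> T) A * chi (S \<inter> T) A)"
    by (simp add: Int_commute)
  then show ?thesis
    using assms by (subst chi_Un_disjoint) (auto simp: chi_square)
qed

lemma chi_cong_inter: "(\<And>i. i \<in> S \<Longrightarrow> i \<in> A \<longleftrightarrow> i \<in> B) \<Longrightarrow> chi S A = chi S B"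
  by (auto simp: chi_def intro!: prod.cong)

lemma sum_Pow_insert:
  assumes "finite N" "a \<notin> N"
  shows "(\<Sum>S\<in>Pow (insert a N). f S) = (\<Sum>S\<in>Pow N. f S + f (insert a S))"
proof -
  have "inj_on (insert a) (Pow N)"
    using assms by (intro inj_onI) (auto simp: insert_ident subset_iff)
  moreover have "Pow N \<inter> insert a ` Pow N = {}"
    using assms by auto
  ultimately show ?thesis
    using assms by (simp add: Pow_insert sum.union_disjoint sum.reindex sum.distrib)
qed

lemma sum_Pow_card:
  assumes "finite N"
  shows "(\<Sum>K\<in>Pow N. f (card K)) = (\<Sum>j\<le>card N. of_nat (card N choose j) * (f j :: real))"
proof -
  have "(\<Sum>K\<in>Pow N. f (card K)) = (\<Sum>j\<le>card N. \<Sum>K\<in>{K\<in>Pow N. card K = j}. f (card K))"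
    using assms by (intro sum.group[symmetric]) (auto intro: card_mono)
  also have "\<dots> = (\<Sum>j\<le>card N. of_nat (card N choose j) * f j)"
    using n_subsets[OF assms] by (intro sum.cong) auto
  finally show ?thesis .
qed

lemma sum_Pow_binomial:
  assumes "finite N"
  shows "(\<Sum>K\<in>Pow N. a ^ card K * b ^ (card N - card K)) = (a + b :: real) ^ card N"
  by (subst sum_Pow_card[OF assms]) (simp add: binomial_ring mult.assoc)

section \<open>Bonami's inequality on the cube\<close>

lemma walsh_insert:
  assumes "finite N" "a \<notin> N" "A \<subseteq> N"
  shows "walsh (insert a N) c A = walsh N c A - walsh N (\<lambda>S. c (insert a S)) A"
    and "walsh (insert a N) c (insert a A) = walsh N c A + walsh N (\<lambda>S. c (insert a S)) A"
proof -
  have "chi (insert a S) A = - chi S A" "chi (insert a S) (insert a A) = chi S A"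
    "chi S (insert a A) = chi S A" if "S \<in> Pow N" for S
  proof -
    have S: "finite S" "a \<notin> S" "a \<notin> A"
      using that assms by (auto intro: finite_subset)
    then show "chi S (insert a A) = chi S A"
      by (intro chi_cong_inter) auto
    with S show "chi (insert a S) A = - chi S A" "chi (insert a S) (insert a A) = chi S A"
      by (simp_all add: chi_insert)
  qed
  then show "walsh (insert a N) c A = walsh N c A - walsh N (\<lambda>S. c (insert a S)) A"
    and "walsh (insert a N) c (insert a A) = walsh N c A + walsh N (\<lambda>S. c (insert a S)) A"
    using assms by (simp_all add: walsh_def sum_Pow_insert sum.distrib sum_subtractf)
qed

text \<open>Induction on \<open>N\<close>, writing the polynomial as q + x_a r. In (q - r)^4 + (q +
  r)^4 the odd terms cancel, Cauchy-Schwarz bounds the mixed term q^2 r^2, and the weight 3 per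
  variable absorbs its coefficient 12. The weights 3^|S| take the place of a degree bound, so the
  induction hypothesis applies to q and r unchanged.\<close>

lemma bonami:
  assumes "finite N"
  shows "(\<Sum>A\<in>Pow N. walsh N c A ^ 4) \<le> 2 ^ card N * (\<Sum>S\<in>Pow N. 3 ^ card S * (c S)\<^sup>2)\<^sup>2"
  using assms
proof (induction N arbitrary: c)
  case empty
  then show ?case by (simp add: walsh_def flip: power_mult)
next
  case (insert a N)
  define c' where "c' = (\<lambda>S. c (insert a S))"
  define q r where "q = walsh N c" and "r = walsh N c'"
  define Q where "Q = (\<Sum>S\<in>Pow N. 3 ^ card S * (c S)\<^sup>2)"
  define R where "R = (\<Sum>S\<in>Pow N. 3 ^ card S * (c' S)\<^sup>2)"
  define k :: real where "k = 2 ^ card N"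
  have [simp]: "Q \<ge> 0" "R \<ge> 0" "k \<ge> 0"
    by (auto simp: Q_def R_def k_def intro!: sum_nonneg)
  have q4: "(\<Sum>A\<in>Pow N. q A ^ 4) \<le> k * Q\<^sup>2" and r4: "(\<Sum>A\<in>Pow N. r A ^ 4) \<le> k * R\<^sup>2"
    using insert.IH[of c] insert.IH[of c'] by (simp_all add: q_def r_def Q_def R_def k_def)
  have "(\<Sum>A\<in>Pow N. (q A)\<^sup>2 * (r A)\<^sup>2)\<^sup>2 \<le> (\<Sum>A\<in>Pow N. q A ^ 4) * (\<Sum>A\<in>Pow N. r A ^ 4)"
    using Cauchy_Schwarz_ineq_sum[of "\<lambda>A. (q A)\<^sup>2" "\<lambda>A. (r A)\<^sup>2" "Pow N"]
    by (simp flip: power_mult)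
  also have "\<dots> \<le> (k * Q\<^sup>2) * (k * R\<^sup>2)"
    using q4 r4 by (intro mult_mono) (auto intro!: sum_nonneg)
  also have "\<dots> = (k * (Q * R))\<^sup>2"
    by (simp add: power_mult_distrib power2_eq_square)
  finally have qr: "(\<Sum>A\<in>Pow N. (q A)\<^sup>2 * (r A)\<^sup>2) \<le> k * (Q * R)"
    by (rule power2_le_imp_le) simp
  have "(\<Sum>A\<in>Pow (insert a N). walsh (insert a N) c A ^ 4)
      = (\<Sum>A\<in>Pow N. (q A - r A) ^ 4 + (q A + r A) ^ 4)"
    using insert.hyps by (simp add: sum_Pow_insert walsh_insert q_def r_def c'_def)
  also have "\<dots> = (\<Sum>A\<in>Pow N. 2 * q A ^ 4 + 12 * ((q A)\<^sup>2 * (r A)\<^sup>2) + 2 * r A ^ 4)"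
    by (intro sum.cong) (auto simp: power4_eq_xxxx power2_eq_square algebra_simps)
  also have "\<dots> = 2 * (\<Sum>A\<in>Pow N. q A ^ 4) + 12 * (\<Sum>A\<in>Pow N. (q A)\<^sup>2 * (r A)\<^sup>2)
      + 2 * (\<Sum>A\<in>Pow N. r A ^ 4)"
    by (simp add: sum.distrib sum_distrib_left)
  also have "\<dots> \<le> 2 * (k * Q\<^sup>2) + 12 * (k * (Q * R)) + 2 * (k * R\<^sup>2)"
    using q4 r4 qr by linarith
  \<comment> \<open>The two sides differ by 16 k R^2.\<close>
  also have "\<dots> \<le> 2 * k * (Q + 3 * R)\<^sup>2"
  proof -
    have "0 \<le> k * R\<^sup>2" by simp
    then show ?thesis by (simp add: power2_eq_square algebra_simps)
  qed
  also have "Q + 3 * R = (\<Sum>S\<in>Pow (insert a N). 3 ^ card S * (c S)\<^sup>2)"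
  proof -
    have "card (insert a S) = Suc (card S)" if "S \<in> Pow N" for S
      using that insert.hyps by (subst card_insert_disjoint) (auto intro: finite_subset)
    then show ?thesis
      using insert.hyps
      by (simp add: sum_Pow_insert sum.distrib Q_def R_def c'_def sum_distrib_left mult.assoc)
  qed
  finally show ?case
    using insert.hyps by (simp add: k_def)
qed

section \<open>Central binomial coefficients\<close>

lemma card_middle:
  assumes "finite N" "even (card N)"
  shows "card (middle N) = card N choose (card N div 2)"
proof -
  have "middle N = {A. A \<subseteq> N \<and> card A = card N div 2}"
    using assms by (auto simp: middle_def)
  then show ?thesis
    using n_subsets[OF assms(1)] by simp
qed

text \<open>With v_n = (n choose n div 2) / 2^n this is (n + 1) v_n <= (n + 2) v_(n+1), cleared of
  denominators. For even n it is an equality; for odd n the central coefficient doubles.\<close>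

lemma central_binomial_step:
  "2 * (n + 1) * (n choose (n div 2)) \<le> (n + 2) * (Suc n choose (Suc n div 2))"
proof (cases "even n")
  case True
  then obtain k where n: "n = 2 * k" by blast
  have "(2 * k + 1) choose k = (2 * k + 1) choose (Suc k)"
    by (subst binomial_symmetric) auto
  then have "Suc k * ((2 * k + 1) choose k) = (2 * k + 1) * (2 * k choose k)"
    using Suc_times_binomial_eq[of "2*k" k] by (simp add: mult.commute)
  then show ?thesis
    by (simp add: n algebra_simps)
next
  case False
  then obtain k where n: "n = 2 * k + 1" by (auto elim: oddE)
  have "(2 * k + 1) choose k = (2 * k + 1) choose (Suc k)"
    by (subst binomial_symmetric) auto
  then have "(Suc n choose (Suc n div 2)) = 2 * (n choose (n div 2))"
    by (simp add: n)
  then show ?thesis by (simp only: n) simp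
qed

lemma central_binomial_mono:
  assumes "j \<le> n"
  shows "real (j + 1) * real (j choose (j div 2)) / 2 ^ j
    \<le> real (n + 1) * real (n choose (n div 2)) / 2 ^ n"
  using assms
proof (induction n rule: dec_induct)
  case (step n)
  have "real (n + 1) * real (n choose (n div 2)) / 2 ^ n
      = real (2 * (n + 1) * (n choose (n div 2))) / 2 ^ Suc n"
    by (simp add: field_simps)
  also have "\<dots> \<le> real ((n + 2) * (Suc n choose (Suc n div 2))) / 2 ^ Suc n"
    using central_binomial_step[of n] by (intro divide_right_mono) (simp_all only: of_nat_le_iff, simp)
  also have "\<dots> = real (Suc n + 1) * real (Suc n choose (Suc n div 2)) / 2 ^ Suc n"
    by (simp add: algebra_simps del: binomial_Suc_Suc)
  finally have "real (n + 1) * real (n choose (n div 2)) / 2 ^ n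
      \<le> real (Suc n + 1) * real (Suc n choose (Suc n div 2)) / 2 ^ Suc n" .
  with step.IH show ?case by (rule order_trans)
qed simp

text \<open>
  By monotonicity of \<open>(j + 1) v\<^sub>j\<close>, where \<open>v\<^sub>j\<close> is the normalised central binomial coefficient, the left
  side is at most \<open>v\<^sub>n\<close> times the mean of \<open>(n + 1) / (J + 1)\<close> for binomial \<open>J\<close>; absorption bounds it by \<open>1 / p\<close>.
\<close>

lemma binomial_average_central:
  assumes "0 < p" "p \<le> (1::real)"
  shows "(\<Sum>j\<le>n. real (n choose j) * (p ^ j * (1 - p) ^ (n - j) * (real (j choose (j div 2)) / 2 ^ j)))
    \<le> real (n choose (n div 2)) / 2 ^ n / p"
proof -
  define v where "v j = real (j choose (j div 2)) / 2 ^ j" for j :: nat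
  have "(\<Sum>j\<le>n. real (n choose j) * (p ^ j * (1 - p) ^ (n - j) * v j))
      \<le> (\<Sum>j\<le>n. real (Suc n choose Suc j) * (p ^ Suc j * (1 - p) ^ (Suc n - Suc j)) * (v n / p))"
  proof (rule sum_mono)
    fix j assume "j \<in> {..n}"
    then have "real (j + 1) * v j \<le> real (n + 1) * v n"
      using central_binomial_mono[of j n] by (simp add: v_def)
    then have "v j \<le> real (n + 1) / real (j + 1) * v n"
      by (simp add: field_simps)
    then have "real (n choose j) * (p ^ j * (1 - p) ^ (n - j) * v j)
        \<le> real (n choose j) * (p ^ j * (1 - p) ^ (n - j) * (real (n + 1) / real (j + 1) * v n))"
      using assms by (intro mult_left_mono) auto
    also have "\<dots> = (real (n choose j) * real (n + 1) / real (j + 1)) * (p ^ j * (1 - p) ^ (n - j)) * v n"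
      by simp
    also have "real (n choose j) * real (n + 1) / real (j + 1) = real (Suc n choose Suc j)"
    proof -
      have "real (Suc n * (n choose j)) = real ((Suc n choose Suc j) * Suc j)"
        by (simp only: Suc_times_binomial_eq)
      then show ?thesis by (simp add: field_simps del: binomial_Suc_Suc)
    qed
    finally show "real (n choose j) * (p ^ j * (1 - p) ^ (n - j) * v j)
        \<le> real (Suc n choose Suc j) * (p ^ Suc j * (1 - p) ^ (Suc n - Suc j)) * (v n / p)"
      using assms by (simp add: mult.assoc del: binomial_Suc_Suc)
  qed
  also have "\<dots> = (\<Sum>j\<le>n. real (Suc n choose Suc j) * (p ^ Suc j * (1 - p) ^ (Suc n - Suc j))) * (v n / p)"
    by (simp only: sum_distrib_right)
  also have "\<dots> \<le> 1 * (v n / p)"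
  proof (rule mult_right_mono)
    \<comment> \<open>The sum to be bounded is the expansion of (p + (1 - p))^(n+1) = 1 with its j =
      0 term removed.\<close>
    have "(p + (1 - p)) ^ Suc n = (\<Sum>j\<le>Suc n. real (Suc n choose j) * p ^ j * (1 - p) ^ (Suc n - j))"
      by (rule binomial_ring)
    also have "\<dots> = (1 - p) ^ Suc n
        + (\<Sum>j\<le>n. real (Suc n choose Suc j) * (p ^ Suc j * (1 - p) ^ (Suc n - Suc j)))"
      by (subst sum.atMost_Suc_shift) (simp add: mult.assoc)
    finally have "(1 - p) ^ Suc n
        + (\<Sum>j\<le>n. real (Suc n choose Suc j) * (p ^ Suc j * (1 - p) ^ (Suc n - Suc j))) = 1"
      by simp
    moreover have "0 \<le> (1 - p) ^ Suc n" using assms by (intro zero_le_power) simp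
    ultimately show "(\<Sum>j\<le>n. real (Suc n choose Suc j) * (p ^ Suc j * (1 - p) ^ (Suc n - Suc j))) \<le> 1"
      by linarith
    show "0 \<le> v n / p" using assms by (simp add: v_def)
  qed
  finally show ?thesis by (simp add: v_def)
qed

section \<open>The noise operator and the middle slice\<close>

text \<open>If \<open>S\<close> avoids \<open>K\<close>, resampling \<open>K\<close> does not touch
  the monomial. Otherwise fix \<open>a\<close> in both: \<open>B\<close> and
  \<open>insert a B\<close> give opposite values and cancel.\<close>

lemma sum_chi_resample:
  assumes "finite K" "finite S"
  shows "(\<Sum>B\<in>Pow K. chi S ((A - K) \<union> B)) = (if S \<inter> K = {} then 2 ^ card K * chi S A else 0)"
proof (cases "S \<inter> K = {}")
  case True
  then have "chi S ((A - K) \<union> B) = chi S A" if "B \<in> Pow K" for B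
    using that by (intro chi_cong_inter) auto
  with True assms show ?thesis by (simp add: card_Pow)
next
  case False
  then obtain a where a: "a \<in> S" "a \<in> K" by blast
  have S: "S = insert a (S - {a})" and K: "K = insert a (K - {a})"
    using a by auto
  have cancel: "chi S ((A - K) \<union> B) + chi S ((A - K) \<union> insert a B) = 0" if "B \<in> Pow (K - {a})" for B
  proof -
    have "chi (S - {a}) ((A - K) \<union> insert a B) = chi (S - {a}) ((A - K) \<union> B)"
      by (intro chi_cong_inter) auto
    moreover have "chi S X = (if a \<in> X then 1 else - 1) * chi (S - {a}) X" for X
      using chi_insert[of "S - {a}" a X] assms S by simp
    moreover have "a \<notin> (A - K) \<union> B" using a that by auto
    ultimately show ?thesis using a by simp
  qed
  have "(\<Sum>B\<in>Pow K. chi S ((A - K) \<union> B)) = (\<Sum>B\<in>Pow (insert a (K - {a})). chi S ((A - K) \<union> B))"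
    using K by simp
  also have "\<dots> = (\<Sum>B\<in>Pow (K - {a}). chi S ((A - K) \<union> B) + chi S ((A - K) \<union> insert a B))"
    using assms by (intro sum_Pow_insert) auto
  also have "\<dots> = 0" using cancel by (intro sum.neutral) auto
  finally show ?thesis using False by simp
qed

text \<open>For rho in [0, 1], put each coordinate into \<open>K\<close> independently with
  probability 1 - rho and resample \<open>K\<close>. The monomial x^S survives exactly when
  \<open>K\<close> misses \<open>S\<close>, which has probability rho^|S|.\<close>

lemma walsh_noise:
  assumes "finite N"
  shows "walsh N (\<lambda>S. \<rho> ^ card S * c S) A =
    (\<Sum>K\<in>Pow N. (1 - \<rho>) ^ card K * \<rho> ^ (card N - card K) / 2 ^ card K *
      (\<Sum>B\<in>Pow K. walsh N c ((A - K) \<union> B)))"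
proof -
  define w where "w K = (1 - \<rho>) ^ card K * \<rho> ^ (card N - card K)" for K :: "'a set"
  have avg: "(\<Sum>K\<in>Pow N. w K / 2 ^ card K * (\<Sum>B\<in>Pow K. chi S ((A - K) \<union> B))) = \<rho> ^ card S * chi S A"
    if S: "S \<in> Pow N" for S
  proof -
    have [simp]: "finite S" and fin: "\<And>K. K \<in> Pow N \<Longrightarrow> finite K"
      using S assms by (auto intro: finite_subset)
    have "(\<Sum>K\<in>Pow N. w K / 2 ^ card K * (\<Sum>B\<in>Pow K. chi S ((A - K) \<union> B)))
        = (\<Sum>K\<in>Pow N. if K \<in> Pow (N - S) then w K * chi S A else 0)"
      by (intro sum.cong refl, subst sum_chi_resample) (auto simp: fin)
    also have "\<dots> = (\<Sum>K\<in>Pow (N - S). w K * chi S A)"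
      using assms by (subst sum.inter_restrict[symmetric]) (auto intro!: sum.cong)
    \<comment> \<open>For \<open>K\<close> inside \<open>N - S\<close> the exponent |N| - |K| splits
      off |S|; the remaining weights sum to 1.\<close>
    also have "\<dots> = (\<Sum>K\<in>Pow (N - S). \<rho> ^ card S * chi S A * ((1 - \<rho>) ^ card K * \<rho> ^ (card (N - S) - card K)))"
    proof (intro sum.cong refl)
      fix K assume "K \<in> Pow (N - S)"
      then have "card K \<le> card (N - S)" using assms by (auto intro: card_mono)
      moreover have "card (N - S) = card N - card S" "card S \<le> card N"
        using S assms by (auto intro: card_Diff_subset card_mono)
      ultimately have "card N - card K = card S + (card (N - S) - card K)" by simp
      then show "w K * chi S A
          = \<rho> ^ card S * chi S A * ((1 - \<rho>) ^ card K * \<rho> ^ (card (N - S) - card K))"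
        by (simp add: w_def power_add)
    qed
    also have "\<dots> = \<rho> ^ card S * chi S A"
      using assms by (simp add: sum_Pow_binomial flip: sum_distrib_left)
    finally show ?thesis .
  qed
  have "(\<Sum>K\<in>Pow N. w K / 2 ^ card K * (\<Sum>B\<in>Pow K. walsh N c ((A - K) \<union> B)))
      = (\<Sum>K\<in>Pow N. \<Sum>S\<in>Pow N. c S * (w K / 2 ^ card K * (\<Sum>B\<in>Pow K. chi S ((A - K) \<union> B))))"
    unfolding walsh_def
    by (subst sum.swap[of _ "Pow N"]) (simp add: sum_distrib_left mult_ac)
  also have "\<dots> = (\<Sum>S\<in>Pow N. c S * (\<Sum>K\<in>Pow N. w K / 2 ^ card K * (\<Sum>B\<in>Pow K. chi S ((A - K) \<union> B))))"
    by (subst sum.swap) (simp add: sum_distrib_left)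
  also have "\<dots> = walsh N (\<lambda>S. \<rho> ^ card S * c S) A"
    unfolding walsh_def using avg by (intro sum.cong) (auto simp: mult_ac)
  finally show ?thesis by (simp add: w_def)
qed

lemma sum_power4_le:
  fixes w y :: "'b \<Rightarrow> real"
  assumes "finite I" "\<And>i. i \<in> I \<Longrightarrow> 0 \<le> w i" "sum w I = 1"
  shows "(\<Sum>i\<in>I. w i * y i) ^ 4 \<le> (\<Sum>i\<in>I. w i * y i ^ 4)"
proof -
  have "I \<noteq> {}" using assms by auto
  then show ?thesis
    using convex_on_sum[of I UNIV "\<lambda>x. x ^ 4" w y] assms by (simp add: convex_power_even)
qed

text \<open>Jensen's inequality for x^4, first over \<open>K\<close> and then over the uniform
  \<open>B\<close>, moves the fourth power inside the average.\<close>

lemma walsh_noise_power4_le: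
  assumes "finite N" "0 \<le> \<rho>" "\<rho> \<le> 1"
  shows "walsh N (\<lambda>S. \<rho> ^ card S * c S) A ^ 4 \<le>
    (\<Sum>K\<in>Pow N. (1 - \<rho>) ^ card K * \<rho> ^ (card N - card K) / 2 ^ card K *
      (\<Sum>B\<in>Pow K. walsh N c ((A - K) \<union> B) ^ 4))"
proof -
  define w where "w K = (1 - \<rho>) ^ card K * \<rho> ^ (card N - card K)" for K :: "'a set"
  have fin: "finite K" if "K \<in> Pow N" for K
    using that assms by (auto intro: finite_subset)
  have "walsh N (\<lambda>S. \<rho> ^ card S * c S) A ^ 4
      = (\<Sum>K\<in>Pow N. w K * (\<Sum>B\<in>Pow K. 1 / 2 ^ card K * walsh N c ((A - K) \<union> B))) ^ 4"
    unfolding walsh_noise[OF assms(1)] w_def by (simp add: sum_distrib_left sum_divide_distrib)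
  also have "\<dots> \<le> (\<Sum>K\<in>Pow N. w K * (\<Sum>B\<in>Pow K. 1 / 2 ^ card K * walsh N c ((A - K) \<union> B)) ^ 4)"
    using assms by (intro sum_power4_le) (auto simp: w_def sum_Pow_binomial)
  also have "\<dots> \<le> (\<Sum>K\<in>Pow N. w K * (\<Sum>B\<in>Pow K. 1 / 2 ^ card K * walsh N c ((A - K) \<union> B) ^ 4))"
    using assms fin by (intro sum_mono mult_left_mono sum_power4_le) (auto simp: w_def card_Pow)
  finally show ?thesis
    by (simp add: w_def sum_distrib_left sum_divide_distrib)
qed

text \<open>The outcome \<open>Z\<close> determines \<open>B\<close> as Z \<inter> K and also
  \<open>A\<close> outside \<open>K\<close>. Only A \<inter> K is free, and its size is forced by 2
  |A| = |N|, so each \<open>Z\<close> arises from at most a central binomial number of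
  pairs.\<close>

lemma sum_middle_resample_le:
  fixes F :: "'a set \<Rightarrow> real"
  assumes "finite N" "K \<subseteq> N" and F: "\<And>A. 0 \<le> F A"
  shows "(\<Sum>A\<in>middle N. \<Sum>B\<in>Pow K. F ((A - K) \<union> B))
    \<le> real (card K choose (card K div 2)) * (\<Sum>Z\<in>Pow N. F Z)"
proof -
  have fin: "finite K" "finite (middle N)"
    using assms by (auto intro: finite_subset simp: middle_def)
  have "(\<Sum>A\<in>middle N. \<Sum>B\<in>Pow K. F ((A - K) \<union> B))
      = (\<Sum>(A, B)\<in>middle N \<times> Pow K. F ((A - K) \<union> B))"
    by (simp add: sum.cartesian_product)
  also have "\<dots> = (\<Sum>Z\<in>Pow N. \<Sum>(A, B)\<in>{p \<in> middle N \<times> Pow K. (fst p - K) \<union> snd p = Z}. F ((A - K) \<union> B))"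
    using fin assms by (intro sum.group[symmetric]) (auto simp: middle_def)
  also have "\<dots> \<le> (\<Sum>Z\<in>Pow N. real (card K choose (card K div 2)) * F Z)"
  proof (rule sum_mono)
    fix Z assume "Z \<in> Pow N"
    define P where "P = {p \<in> middle N \<times> Pow K. (fst p - K) \<union> snd p = Z}"
    \<comment> \<open>Truncated subtraction is harmless: if \<open>Z - K\<close> exceeds half of
      \<open>N\<close>, then \<open>P\<close> is empty.\<close>
    define k where "k = card N div 2 - card (Z - K)"
    have "fst p = (fst p \<inter> K) \<union> (Z - K) \<and> snd p = Z \<inter> K" if "p \<in> P" for p
      using that by (auto simp: P_def)
    then have inj: "inj_on (\<lambda>p. fst p \<inter> K) P"
      by (intro inj_onI) (metis prod_eqI)
    have "(\<lambda>p. fst p \<inter> K) ` P \<subseteq> {Q. Q \<subseteq> K \<and> card Q = k}"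
    proof safe
      fix A B assume "(A, B) \<in> P"
      then have A: "A \<subseteq> N" "2 * card A = card N" and Z: "Z - K = A - K"
        by (auto simp: P_def middle_def)
      have "card A = card (A \<inter> K) + card (A - K)"
        using A assms by (metis card_Int_Diff finite_subset)
      then show "card (fst (A, B) \<inter> K) = k"
        using A Z by (simp add: k_def)
    qed
    then have "card P \<le> card {Q. Q \<subseteq> K \<and> card Q = k}"
      using fin by (intro card_inj_on_le[OF inj]) auto
    also have "\<dots> \<le> card K choose (card K div 2)"
      by (simp add: n_subsets fin binomial_maximum)
    finally have "real (card P) * F Z \<le> real (card K choose (card K div 2)) * F Z"
      using F by (intro mult_right_mono) auto
    moreover have "(\<Sum>(A, B)\<in>P. F ((A - K) \<union> B)) = (\<Sum>p\<in>P. F Z)"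
      by (intro sum.cong) (auto simp: P_def)
    ultimately show "(\<Sum>(A, B)\<in>{p \<in> middle N \<times> Pow K. (fst p - K) \<union> snd p = Z}. F ((A - K) \<union> B))
        \<le> real (card K choose (card K div 2)) * F Z"
      by (simp add: P_def)
  qed
  finally show ?thesis by (simp add: sum_distrib_left)
qed

text \<open>Resampling \<open>K\<close> spreads the slice over the cube with a density controlled by
  the central binomial coefficient of |K|. As |K| is binomial with parameter 1 - rho,
  \<open>binomial_average_central\<close> turns the average into the factor 1 / (1 - rho).\<close>

lemma sum_middle_noise_power4_le:
  assumes "finite N" "even (card N)" "0 \<le> \<rho>" "\<rho> < 1"
  shows "(\<Sum>A\<in>middle N. walsh N (\<lambda>S. \<rho> ^ card S * c S) A ^ 4)
    \<le> real (card (middle N)) / 2 ^ card N / (1 - \<rho>) * (\<Sum>A\<in>Pow N. walsh N c A ^ 4)"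
proof -
  define w where "w j = (1 - \<rho>) ^ j * \<rho> ^ (card N - j)" for j :: nat
  define F where "F A = walsh N c A ^ 4" for A
  have "(\<Sum>A\<in>middle N. walsh N (\<lambda>S. \<rho> ^ card S * c S) A ^ 4)
      \<le> (\<Sum>A\<in>middle N. \<Sum>K\<in>Pow N. w (card K) / 2 ^ card K * (\<Sum>B\<in>Pow K. F ((A - K) \<union> B)))"
    using assms unfolding w_def F_def by (intro sum_mono walsh_noise_power4_le) auto
  also have "\<dots> = (\<Sum>K\<in>Pow N. w (card K) / 2 ^ card K * (\<Sum>A\<in>middle N. \<Sum>B\<in>Pow K. F ((A - K) \<union> B)))"
    by (subst sum.swap) (simp add: sum_distrib_left)
  also have "\<dots> \<le> (\<Sum>K\<in>Pow N. w (card K) / 2 ^ card K *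
      (real (card K choose (card K div 2)) * (\<Sum>Z\<in>Pow N. F Z)))"
    using assms by (intro sum_mono mult_left_mono sum_middle_resample_le) (auto simp: F_def w_def)
  also have "\<dots> = (\<Sum>K\<in>Pow N. w (card K) * (real (card K choose (card K div 2)) / 2 ^ card K)) * (\<Sum>Z\<in>Pow N. F Z)"
    by (simp add: sum_distrib_right mult.assoc)
  also have "(\<Sum>K\<in>Pow N. w (card K) * (real (card K choose (card K div 2)) / 2 ^ card K))
      = (\<Sum>j\<le>card N. real (card N choose j) * (w j * (real (j choose (j div 2)) / 2 ^ j)))"
    by (rule sum_Pow_card[OF assms(1)])
  also have "\<dots> * (\<Sum>Z\<in>Pow N. F Z)
      \<le> real (card N choose (card N div 2)) / 2 ^ card N / (1 - \<rho>) * (\<Sum>Z\<in>Pow N. F Z)"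
    using binomial_average_central[of "1 - \<rho>" "card N"] assms
    by (intro mult_right_mono) (auto simp: w_def F_def intro!: sum_nonneg)
  finally show ?thesis
    using assms by (simp add: card_middle F_def)
qed

section \<open>Moments of monomials on the middle slice\<close>

definition moment :: "'a set \<Rightarrow> 'a set \<Rightarrow> real" where
  "moment N S = (\<Sum>A\<in>middle N. chi S A)"

lemma finite_middle [simp]: "finite N \<Longrightarrow> finite (middle N)"
  by (simp add: middle_def)

text \<open>The slice is invariant under permutations of \<open>N\<close>, and some permutation
  carries \<open>S\<close> onto \<open>T\<close>.\<close>

lemma moment_cong_card:
  assumes "finite N" "S \<subseteq> N" "T \<subseteq> N" "card S = card T"
  shows "moment N S = moment N T"
proof -
  have fin: "finite S" "finite T" using assms by (auto intro: finite_subset)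
  then obtain f where f: "bij_betw f S T"
    using assms finite_same_card_bij by blast
  have "card (N - S) = card (N - T)"
    using assms fin by (simp add: card_Diff_subset)
  then obtain h where h: "bij_betw h (N - S) (N - T)"
    using assms finite_same_card_bij by (metis finite_Diff)
  define \<pi> where "\<pi> i = (if i \<in> S then f i else h i)" for i
  have \<pi>S: "bij_betw \<pi> S T"
    using f by (rule bij_betw_cong[THEN iffD1, rotated]) (simp add: \<pi>_def)
  have "bij_betw \<pi> (N - S) (N - T)"
    using h by (rule bij_betw_cong[THEN iffD1, rotated]) (simp add: \<pi>_def)
  with \<pi>S have "bij_betw \<pi> (S \<union> (N - S)) (T \<union> (N - T))"
    by (intro bij_betw_combine) auto
  then have \<pi>: "bij_betw \<pi> N N"
    using assms by (simp add: Un_absorb1)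
  then have inj: "inj_on \<pi> N" and im: "\<pi> ` N = N" by (auto simp: bij_betw_def)
  have Pow: "bij_betw (image \<pi>) (Pow N) (Pow N)"
    using \<pi> by (rule bij_betw_Pow)
  have card: "card (\<pi> ` A) = card A" if "A \<subseteq> N" for A
    using card_image inj inj_on_subset that by blast
  have "bij_betw (image \<pi>) (middle N) (middle N)"
    unfolding bij_betw_def
  proof
    show "inj_on (image \<pi>) (middle N)"
      using Pow by (auto simp: bij_betw_def middle_def intro: inj_on_subset)
    show "image \<pi> ` middle N = middle N"
    proof (intro equalityI subsetI)
      fix B assume "B \<in> image \<pi> ` middle N"
      then show "B \<in> middle N" using im card by (auto simp: middle_def)
    next
      fix B assume B: "B \<in> middle N"
      then have "B \<in> image \<pi> ` Pow N"
        using Pow by (auto simp: bij_betw_def middle_def)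
      then obtain A where "A \<subseteq> N" "B = \<pi> ` A" by auto
      with B card show "B \<in> image \<pi> ` middle N" by (auto simp: middle_def)
    qed
  qed
  then have "moment N T = (\<Sum>A\<in>middle N. chi T (\<pi> ` A))"
    unfolding moment_def by (rule sum.reindex_bij_betw[symmetric])
  also have "\<dots> = moment N S"
    unfolding moment_def
  proof (rule sum.cong)
    fix A assume "A \<in> middle N"
    then have A: "A \<subseteq> N" by (simp add: middle_def)
    have "chi T (\<pi> ` A) = (\<Prod>i\<in>S. if \<pi> i \<in> \<pi> ` A then 1 else - 1)"
      unfolding chi_def by (rule prod.reindex_bij_betw[OF \<pi>S, symmetric])
    also have "\<dots> = chi S A"
      unfolding chi_def
    proof (rule prod.cong)
      fix i assume "i \<in> S"
      then have "\<pi> i \<in> \<pi> ` A \<longleftrightarrow> i \<in> A"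
        using inj A assms by (auto dest: inj_onD)
      then show "(if \<pi> i \<in> \<pi> ` A then 1 else - 1) = (if i \<in> A then 1 else - 1 :: real)" by simp
    qed simp
    finally show "chi T (\<pi> ` A) = chi S A" .
  qed simp
  finally show ?thesis by simp
qed

lemma sum_signs_middle:
  assumes "finite N" "A \<in> middle N"
  shows "(\<Sum>i\<in>N. if i \<in> A then 1 else - 1 :: real) = 0"
proof -
  have A: "A \<subseteq> N" "2 * card A = card N" using assms by (auto simp: middle_def)
  have "(\<Sum>i\<in>N. if i \<in> A then 1 else - 1 :: real) = real (card (N \<inter> A)) - real (card (N - A))"
    using assms by (simp add: sum.If_cases Diff_eq)
  also have "N \<inter> A = A" using A by auto
  also have "real (card (N - A)) = real (card N) - real (card A)"
    using A assms by (simp add: card_Diff_subset card_mono finite_subset of_nat_diff)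
  also have "\<dots> = real (card A)" using A(2) by (simp flip: A(2))
  finally show ?thesis by simp
qed

text \<open>On the slice the coordinates sum to zero. Multiply this by x^R and reduce with x_i^2 =
  1: each x_i x^R adds i to \<open>R\<close> or removes it.\<close>

lemma chi_middle_relation:
  assumes "finite N" "A \<in> middle N" "R \<subseteq> N"
  shows "(\<Sum>i\<in>N - R. chi (insert i R) A) + (\<Sum>i\<in>R. chi (R - {i}) A) = 0"
proof -
  define s where "s i = (if i \<in> A then 1 else - 1 :: real)" for i
  have fin: "finite R" using assms by (auto intro: finite_subset)
  have 1: "chi (insert i R) A = s i * chi R A" if "i \<in> N - R" for i
    using that fin by (simp add: chi_insert s_def)
  have 2: "chi (R - {i}) A = s i * chi R A" if "i \<in> R" for i
  proof -
    have "chi R A = s i * chi (R - {i}) A"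
      using chi_insert[of "R - {i}" i A] fin that by (simp add: s_def insert_absorb)
    then show ?thesis by (simp add: s_def)
  qed
  have "(\<Sum>i\<in>N - R. chi (insert i R) A) + (\<Sum>i\<in>R. chi (R - {i}) A)
      = (\<Sum>i\<in>N - R. s i * chi R A) + (\<Sum>i\<in>R. s i * chi R A)"
    using 1 2 by simp
  also have "\<dots> = (\<Sum>i\<in>N. s i) * chi R A"
    using assms sum.subset_diff[of R N s] by (simp add: algebra_simps flip: sum_distrib_right)
  finally show ?thesis using sum_signs_middle[OF assms(1,2)] by (simp add: s_def)
qed

text \<open>Sum the relation for a set \<open>R\<close> of size 2j + 1 over the slice. By symmetry
  it reads (|N| - 2j - 1) m_(2j+2) = -(2j + 1) m_(2j), so the even moments alternate in
  sign.\<close>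

lemma moment_sign:
  assumes "finite N" "S \<subseteq> N" "card S = 2 * j"
  shows "0 \<le> (-1) ^ j * moment N S"
  using assms(2,3)
proof (induction j arbitrary: S)
  case 0
  then have "S = {}" using assms(1) finite_subset by fastforce
  then show ?case by (simp add: moment_def)
next
  case (Suc j)
  have fin: "finite S" using Suc.prems assms(1) finite_subset by blast
  obtain a where a: "a \<in> S" using Suc.prems by fastforce
  define R where "R = S - {a}"
  have R: "R \<subseteq> N" "card R = 2 * j + 1" "finite R" "a \<in> N - R"
    using a Suc.prems fin by (auto simp: R_def)
  obtain b where b: "b \<in> R" using R by fastforce
  define Q where "Q = R - {b}"
  have Q: "Q \<subseteq> N" "card Q = 2 * j" using R b by (auto simp: Q_def)
  have "(\<Sum>i\<in>N - R. moment N (insert i R)) + (\<Sum>i\<in>R. moment N (R - {i})) = 0"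
    unfolding moment_def
    using chi_middle_relation[OF assms(1) _ R(1)]
    by (subst (1 2) sum.swap) (simp flip: sum.distrib)
  moreover have "(\<Sum>i\<in>N - R. moment N (insert i R)) = (\<Sum>i\<in>N - R. moment N S)"
    using R Suc.prems assms(1) by (intro sum.cong refl moment_cong_card) auto
  moreover have "(\<Sum>i\<in>R. moment N (R - {i})) = (\<Sum>i\<in>R. moment N Q)"
    using R Q assms(1) by (intro sum.cong refl moment_cong_card) auto
  ultimately have eq: "real (card (N - R)) * moment N S = - (real (card R) * moment N Q)"
    by simp
  have "real (card (N - R)) * ((-1) ^ Suc j * moment N S)
      = - ((-1) ^ j) * (real (card (N - R)) * moment N S)" by simp
  also have "\<dots> = real (card R) * ((-1) ^ j * moment N Q)"
    unfolding eq by simp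
  also have "\<dots> \<ge> 0" using Suc.IH[OF Q] by simp
  finally have "0 \<le> real (card (N - R)) * ((-1) ^ Suc j * moment N S)" .
  moreover have "0 < real (card (N - R))"
    using R(4) assms(1) by (auto simp: card_gt_0_iff)
  ultimately show ?case by (meson linorder_not_le mult_pos_neg)
qed

section \<open>Harmonic polynomials and their pairings on the slice\<close>

text \<open>The sum is the coefficient of x^R in the sum of all partial derivatives of the
  polynomial with coefficients \<open>g\<close>. Each \<open>R\<close> constrains only the level |R|
  + 1.\<close>

definition harmonic :: "'a set \<Rightarrow> ('a set \<Rightarrow> real) \<Rightarrow> bool" where
  "harmonic N g \<longleftrightarrow> (\<forall>R\<subseteq>N. (\<Sum>i\<in>N - R. g (insert i R)) = 0)"

lemma sum_upper_covers:
  assumes "finite N" "R \<subseteq> N"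
  shows "(\<Sum>T | T \<subseteq> N \<and> R \<subseteq> T \<and> card T = Suc (card R). h T) = (\<Sum>i\<in>N - R. h (insert i R))"
proof -
  have fin: "finite R" using assms finite_subset by blast
  have "{T. T \<subseteq> N \<and> R \<subseteq> T \<and> card T = Suc (card R)} = (\<lambda>i. insert i R) ` (N - R)"
  proof (intro equalityI subsetI)
    fix T assume "T \<in> {T. T \<subseteq> N \<and> R \<subseteq> T \<and> card T = Suc (card R)}"
    then have T: "T \<subseteq> N" "card T = Suc (card R)" "R \<subseteq> T" by auto
    then have "card (T - R) = 1" using fin by (simp add: card_Diff_subset)
    then obtain i where "T - R = {i}" by (auto simp: card_1_singleton_iff)
    then show "T \<in> (\<lambda>i. insert i R) ` (N - R)" using T by (intro image_eqI[of _ _ i]) auto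
  qed (use assms fin in auto)
  moreover have "inj_on (\<lambda>i. insert i R) (N - R)" by (auto intro!: inj_onI)
  ultimately show ?thesis by (simp add: sum.reindex)
qed

lemma sum_lower_covers:
  assumes "finite R"
  shows "(\<Sum>T | T \<subseteq> R \<and> Suc (card T) = card R. h T) = (\<Sum>i\<in>R. h (R - {i}))"
proof -
  have "{T. T \<subseteq> R \<and> Suc (card T) = card R} = (\<lambda>i. R - {i}) ` R"
  proof (intro equalityI subsetI)
    fix T assume "T \<in> {T. T \<subseteq> R \<and> Suc (card T) = card R}"
    then have T: "T \<subseteq> R" "Suc (card T) = card R" by auto
    then have "card (R - T) = 1" using assms by (simp add: card_Diff_subset finite_subset)
    then obtain i where "R - T = {i}" by (auto simp: card_1_singleton_iff)
    then show "T \<in> (\<lambda>i. R - {i}) ` R" using T by (intro image_eqI[of _ _ i]) auto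
  next
    fix T assume "T \<in> (\<lambda>i. R - {i}) ` R"
    then obtain i where "i \<in> R" "T = R - {i}" by auto
    then show "T \<in> {T. T \<subseteq> R \<and> Suc (card T) = card R}"
      using card_Suc_Diff1[OF assms \<open>i \<in> R\<close>] by auto
  qed
  moreover have "inj_on (\<lambda>i. R - {i}) R" by (auto intro!: inj_onI)
  ultimately show ?thesis by (simp add: sum.reindex)
qed

text \<open>Induction on the gap l - |R|: adding the zero sums for \<open>insert i R\<close> over
  all i outside \<open>R\<close> counts each \<open>T\<close> exactly |T - R| times.\<close>

lemma harmonic_sum_supersets:
  assumes "finite N" "harmonic N g" "R \<subseteq> N" "card R < l"
  shows "(\<Sum>T | T \<subseteq> N \<and> card T = l \<and> R \<subseteq> T. g T) = 0"
proof -
  have "(\<Sum>T | T \<subseteq> N \<and> card T = card R + Suc j \<and> R \<subseteq> T. g T) = 0" if "R \<subseteq> N" for j R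
    using that
  proof (induction j arbitrary: R)
    case 0
    then show ?case
      using sum_upper_covers[OF assms(1) 0, of g] assms(2) by (simp add: harmonic_def conj_comms)
  next
    case (Suc j)
    define X where "X = {T. T \<subseteq> N \<and> card T = card R + Suc (Suc j) \<and> R \<subseteq> T}"
    have fin: "finite R" "finite X"
      using Suc assms(1) by (auto simp: X_def intro: finite_subset)
    have "0 = (\<Sum>i\<in>N - R. \<Sum>T | T \<subseteq> N \<and> card T = card (insert i R) + Suc j \<and> insert i R \<subseteq> T. g T)"
      using Suc by (intro sum.neutral[symmetric] ballI Suc.IH) auto
    also have "\<dots> = (\<Sum>i\<in>N - R. \<Sum>T\<in>{T\<in>X. i \<in> T}. g T)"
      using fin by (intro sum.cong refl) (auto simp: X_def)
    also have "\<dots> = (\<Sum>T\<in>X. \<Sum>i\<in>{i\<in>N - R. i \<in> T}. g T)"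
      using fin assms(1) by (intro sum.swap_restrict) auto
    also have "\<dots> = (\<Sum>T\<in>X. real (Suc (Suc j)) * g T)"
    proof (intro sum.cong refl)
      fix T assume T: "T \<in> X"
      then have "{i \<in> N - R. i \<in> T} = T - R" "card (T - R) = Suc (Suc j)"
        using fin by (auto simp: X_def card_Diff_subset)
      then show "(\<Sum>i\<in>{i\<in>N - R. i \<in> T}. g T) = real (Suc (Suc j)) * g T" by simp
    qed
    finally show ?case by (simp add: X_def flip: sum_distrib_left)
  qed
  from this[of R "l - card R - 1"] assms show ?thesis by simp
qed

text \<open>Moebius inversion on the subset lattice. Applied to F (S \<inter> T), it leaves sums
  over the \<open>T\<close> containing a fixed \<open>R\<close>, which harmonicity
  evaluates.\<close>

lemma subset_newton_expansion:
  fixes F :: "'a set \<Rightarrow> real"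
  obtains c where "\<And>Q. finite Q \<Longrightarrow> F Q = (\<Sum>R\<in>Pow Q. c R)"
    and "\<And>Q. finite Q \<Longrightarrow> c Q = (\<Sum>R\<in>Pow Q. (-1) ^ (card Q - card R) * F R)"
proof -
  define h where "h S = (\<Sum>T\<in>Pow S. (-1) ^ card T * F T)" for S
  define c where "c S = (-1) ^ card S * h S" for S
  have F: "F Q = (\<Sum>R\<in>Pow Q. c R)" if "finite Q" for Q
    unfolding c_def by (rule inclusion_exclusion_symmetric[of h F, OF h_def that])
  moreover have "c Q = (\<Sum>R\<in>Pow Q. (-1) ^ (card Q - card R) * F R)" if "finite Q" for Q
    by (rule inclusion_exclusion_mobius[of F c, OF F that])
  ultimately show thesis using that by blast
qed

text \<open>Up to normalisation the sum is the slice average of x^S times the degree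
  \<open>l\<close> part of g. After the Newton expansion in S \<inter> T,
  \<open>harmonic_sum_supersets\<close> kills every \<open>R\<close> with |R| < l. As |S| <= l, what
  remains is R = S in the case l = |S|, and then T = S.\<close>

lemma harmonic_pairing:
  assumes "finite N" "harmonic N g" "S \<subseteq> N" "card S \<le> l"
  obtains \<gamma> where "(\<Sum>T | T \<subseteq> N \<and> card T = l. g T * moment N (sym_diff S T)) = \<gamma> * g S"
    and "if l = card S then real (card (middle N)) \<le> \<gamma> else \<gamma> = 0"
proof -
  \<comment> \<open>The value 0 beyond \<open>card N\<close>, where the choice is empty, keeps the alternating signs of
    \<open>\<mu>\<close>, so \<open>card S\<close> may exceed half of \<open>card N\<close>.\<close>
  define \<mu> where "\<mu> j = (if j \<le> card N then moment N (SOME W. W \<subseteq> N \<and> card W = j) else 0)" for j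
  have \<mu>: "moment N W = \<mu> (card W)" if "W \<subseteq> N" for W
  proof -
    have "(SOME V. V \<subseteq> N \<and> card V = card W) \<subseteq> N \<and> card (SOME V. V \<subseteq> N \<and> card V = card W) = card W"
      using that by (intro someI[of "\<lambda>V. V \<subseteq> N \<and> card V = card W" W]) auto
    then show ?thesis
      using that assms(1) unfolding \<mu>_def by (auto intro!: moment_cong_card card_mono)
  qed
  \<comment> \<open>A set \<open>T\<close> of size \<open>l\<close> has |sym_diff S T| = |S| + l - 2
    |S \<inter> T|, so the moment is a function of the intersection.\<close>
  define F where "F Q = \<mu> (card S + l - 2 * card Q)" for Q :: "'a set"
  obtain c where F: "\<And>Q. finite Q \<Longrightarrow> F Q = (\<Sum>R\<in>Pow Q. c R)"
    and c: "\<And>Q. finite Q \<Longrightarrow> c Q = (\<Sum>R\<in>Pow Q. (-1) ^ (card Q - card R) * F R)"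
    using subset_newton_expansion by blast
  define X where "X = {T. T \<subseteq> N \<and> card T = l}"
  have fin: "finite S" "finite X" "\<And>T. T \<in> X \<Longrightarrow> finite T"
    using assms by (auto simp: X_def intro: finite_subset)
  have "(\<Sum>T\<in>X. g T * moment N (sym_diff S T)) = (\<Sum>T\<in>X. \<Sum>R\<in>{R\<in>Pow S. R \<subseteq> T}. g T * c R)"
  proof (rule sum.cong)
    fix T assume T: "T \<in> X"
    then have "finite T" by (rule fin)
    have "card (sym_diff S T) = card (S - T) + card (T - S)"
      using fin \<open>finite T\<close> by (intro card_Un_disjoint) auto
    also have "\<dots> = card S + l - 2 * card (S \<inter> T)"
    proof -
      have "card S = card (S \<inter> T) + card (S - T)"
        using fin by (intro card_Int_Diff)
      moreover have "card T = card (S \<inter> T) + card (T - S)"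
        using card_Int_Diff[OF \<open>finite T\<close>, of S] by (subst Int_commute)
      moreover have "card T = l" using T by (simp add: X_def)
      ultimately show ?thesis by linarith
    qed
    finally have "moment N (sym_diff S T) = F (S \<inter> T)"
      using T assms by (subst \<mu>) (auto simp: X_def F_def)
    also have "\<dots> = (\<Sum>R\<in>{R\<in>Pow S. R \<subseteq> T}. c R)"
      using fin by (subst F) (auto intro!: sum.cong)
    finally show "g T * moment N (sym_diff S T) = (\<Sum>R\<in>{R\<in>Pow S. R \<subseteq> T}. g T * c R)"
      by (simp add: sum_distrib_left)
  qed simp
  also have "\<dots> = (\<Sum>R\<in>Pow S. \<Sum>T\<in>{T\<in>X. R \<subseteq> T}. g T * c R)"
    using fin by (intro sum.swap_restrict) auto
  also have "\<dots> = (\<Sum>R\<in>Pow S. c R * (\<Sum>T\<in>{T\<in>X. R \<subseteq> T}. g T))"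
    by (simp add: sum_distrib_left mult.commute)
  also have "\<dots> = (\<Sum>R\<in>Pow S. if R = S then (if l = card S then c S * g S else 0) else 0)"
  proof (intro sum.cong refl)
    fix R assume "R \<in> Pow S"
    then have R: "R \<subseteq> S" "R \<subseteq> N" "card R \<le> card S" using assms fin by (auto intro: card_mono)
    show "c R * (\<Sum>T\<in>{T\<in>X. R \<subseteq> T}. g T) = (if R = S then (if l = card S then c S * g S else 0) else 0)"
    proof (cases "R = S \<and> l = card S")
      case True
      have "T = S" if "T \<in> X" "S \<subseteq> T" for T
        using card_subset_eq[OF fin(3)[OF that(1)] that(2)] that True by (simp add: X_def)
      then have "{T\<in>X. R \<subseteq> T} = {S}"
        using True assms(3) by (auto simp: X_def)
      with True show ?thesis by simp
    next
      case False
      have "card R < l"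
      proof (cases "R = S")
        case True
        with False assms(4) show ?thesis by simp
      next
        case False
        with R have "card R < card S" by (intro psubset_card_mono[OF fin(1)]) auto
        with assms(4) show ?thesis by simp
      qed
      then show ?thesis
        using harmonic_sum_supersets[OF assms(1,2) R(2)] False by (simp add: X_def conj_assoc)
    qed
  qed
  also have "\<dots> = (if l = card S then c S else 0) * g S"
    using fin by simp
  finally have 1: "(\<Sum>T | T \<subseteq> N \<and> card T = l. g T * moment N (sym_diff S T))
      = (if l = card S then c S else 0) * g S"
    by (simp add: X_def)
  \<comment> \<open>\<open>c S\<close> is an alternating sum of values of \<open>F\<close>, and
    \<open>moment_sign\<close> makes each signed term nonnegative. The term R = S alone is
    \<open>moment N {}\<close>, the size of the slice.\<close>
  have 2: "real (card (middle N)) \<le> c S" if "l = card S"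
  proof -
    have nonneg: "0 \<le> (-1) ^ (card S - card R) * F R" if "R \<in> Pow S" for R
    proof -
      have R: "R \<subseteq> S" "finite R" using that fin by (auto intro: finite_subset)
      have "card R \<le> card S"
        using R fin by (auto simp: card_mono)
      then have FR: "F R = \<mu> (2 * (card S - card R))"
        using \<open>l = card S\<close> by (simp add: F_def diff_mult_distrib2 mult_2)
      show ?thesis
      proof (cases "2 * (card S - card R) \<le> card N")
        case True
        then obtain W where "W \<subseteq> N" "card W = 2 * (card S - card R)"
          by (rule obtain_subset_with_card_n)
        then show ?thesis
          using moment_sign[OF assms(1)] \<mu> FR by metis
      qed (simp add: FR \<mu>_def)
    qed
    have "real (card (middle N)) = (-1) ^ (card S - card S) * F S"
      using \<mu>[of "{}"] \<open>l = card S\<close> by (simp add: F_def moment_def)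
    also have "\<dots> \<le> c S"
      unfolding c[OF fin(1)] using nonneg fin by (intro member_le_sum) auto
    finally show ?thesis .
  qed
  show thesis using that[OF 1] 2 by auto
qed

section \<open>Reduction to a harmonic polynomial\<close>

text \<open>Gram-Schmidt: project both \<open>f\<close> and the new vector \<open>u b\<close> off
  the old family, then remove from the residue of \<open>f\<close> its component along the residue
  of \<open>u b\<close>.\<close>

lemma orthogonal_projection_exists:
  fixes u :: "'i \<Rightarrow> 'b \<Rightarrow> real"
  assumes "finite I"
  shows "\<exists>q. \<forall>r\<in>I. (\<Sum>x\<in>X. (f x - (\<Sum>i\<in>I. q i * u i x)) * u r x) = 0"
  using assms
proof (induction I arbitrary: f)
  case (insert b I)
  obtain p where p: "\<And>r. r \<in> I \<Longrightarrow> (\<Sum>x\<in>X. (f x - (\<Sum>i\<in>I. p i * u i x)) * u r x) = 0"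
    using insert.IH by blast
  obtain q where q: "\<And>r. r \<in> I \<Longrightarrow> (\<Sum>x\<in>X. (u b x - (\<Sum>i\<in>I. q i * u i x)) * u r x) = 0"
    using insert.IH by blast
  define f' v where "f' x = f x - (\<Sum>i\<in>I. p i * u i x)"
    and "v x = u b x - (\<Sum>i\<in>I. q i * u i x)" for x
  \<comment> \<open>When the denominator is 0, \<open>t\<close> is 0 by convention; then
    \<open>v\<close> vanishes on \<open>X\<close>, or \<open>X\<close> is infinite and every sum
    over it is 0.\<close>
  define t where "t = (\<Sum>x\<in>X. f' x * v x) / (\<Sum>x\<in>X. v x * v x)"
  define s where "s i = (if i = b then t else p i - t * q i)" for i
  have "(\<Sum>i\<in>insert b I. s i * u i x) = t * u b x + (\<Sum>i\<in>I. (p i - t * q i) * u i x)" for x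
    using insert.hyps by (auto simp: s_def intro!: sum.cong)
  then have res: "f x - (\<Sum>i\<in>insert b I. s i * u i x) = f' x - t * v x" for x
    by (simp add: f'_def v_def algebra_simps sum_subtractf sum_distrib_left)
  have I: "(\<Sum>x\<in>X. (f' x - t * v x) * u r x) = 0" if "r \<in> I" for r
    using p[OF that] q[OF that]
    by (simp add: f'_def[symmetric] v_def[symmetric] left_diff_distrib sum_subtractf mult.assoc
        flip: sum_distrib_left)
  have v: "(\<Sum>x\<in>X. (f' x - t * v x) * v x) = 0"
  proof (cases "(\<Sum>x\<in>X. v x * v x) = 0")
    case True
    then have "\<forall>x\<in>X. v x = 0 \<or> infinite X"
      by (metis (no_types, lifting) mult_eq_0_iff sum_nonneg_eq_0_iff zero_le_square)
    then show ?thesis by (cases "finite X") auto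
  next
    case False
    have "(\<Sum>x\<in>X. (f' x - t * v x) * v x) = (\<Sum>x\<in>X. f' x * v x) - t * (\<Sum>x\<in>X. v x * v x)"
      by (simp add: left_diff_distrib sum_subtractf sum_distrib_left mult.assoc)
    with False show ?thesis by (simp add: t_def)
  qed
  have "(\<Sum>x\<in>X. (f' x - t * v x) * u b x)
      = (\<Sum>x\<in>X. (f' x - t * v x) * v x) + (\<Sum>x\<in>X. \<Sum>i\<in>I. q i * ((f' x - t * v x) * u i x))"
  proof -
    have ub: "u b x = v x + (\<Sum>i\<in>I. q i * u i x)" for x
      by (simp add: v_def)
    have "y * u b x = y * v x + (\<Sum>i\<in>I. q i * (y * u i x))" for x y
      unfolding ub by (simp add: distrib_left sum_distrib_left mult.left_commute)
    then show ?thesis by (simp add: sum.distrib)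
  qed
  also have "\<dots> = 0"
    using v I by (subst sum.swap) (simp flip: sum_distrib_left)
  finally have "\<forall>r\<in>insert b I. (\<Sum>x\<in>X. (f x - (\<Sum>i\<in>insert b I. s i * u i x)) * u r x) = 0"
    using I unfolding res by blast
  then show ?case by blast
qed simp

text \<open>Induction on d. Subtracting a combination of relations \<open>e R\<close> with |R| = d
  keeps the values on the slice and can make level d + 1 harmonic; the lower levels go to the
  induction hypothesis. The pieces recombine because each harmonicity condition involves a single
  level.\<close>

lemma harmonic_representative:
  assumes "finite N" "\<And>S. S \<subseteq> N \<Longrightarrow> d < card S \<Longrightarrow> c S = 0"
  shows "\<exists>g. harmonic N g \<and> (\<forall>S\<subseteq>N. d < card S \<longrightarrow> g S = 0) \<and>
    (\<forall>A\<in>middle N. walsh N g A = walsh N c A)"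
  using assms(2)
proof (induction d arbitrary: c)
  case 0
  have "c (insert i R) = 0" if "i \<in> N - R" "R \<subseteq> N" for i R
  proof (rule 0)
    have "finite R" using that(2) assms(1) by (rule finite_subset)
    then show "0 < card (insert i R)" by (simp add: card_gt_0_iff)
  qed (use that in auto)
  then have "harmonic N c" by (auto simp: harmonic_def intro!: sum.neutral)
  then show ?case using 0 by blast
next
  case (Suc d)
  \<comment> \<open>Within \<open>N\<close>, \<open>e R\<close> holds the coefficients of x^R times
    the sum of all coordinates, which vanishes on the slice.\<close>
  define e where "e R T = (if R \<subseteq> T \<and> card T = Suc (card R) \<or> T \<subseteq> R \<and> Suc (card T) = card R
    then 1 else 0 :: real)" for R T :: "'a set"
  have e: "walsh N (e R) A = 0" if "A \<in> middle N" "R \<subseteq> N" for R A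
  proof -
    have fin: "finite R" using that(2) assms(1) by (rule finite_subset)
    define U L where "U = {T. T \<subseteq> N \<and> R \<subseteq> T \<and> card T = Suc (card R)}"
      and "L = {T. T \<subseteq> R \<and> Suc (card T) = card R}"
    have "finite U" "finite L" "U \<inter> L = {}" "U \<union> L \<subseteq> Pow N"
      using assms(1) fin that by (auto simp: U_def L_def)
    then have "walsh N (e R) A = (\<Sum>T\<in>U \<union> L. chi T A)"
      unfolding walsh_def using assms(1)
      by (intro sum.mono_neutral_cong_right) (auto simp: e_def U_def L_def)
    also have "\<dots> = (\<Sum>T\<in>U. chi T A) + (\<Sum>T\<in>L. chi T A)"
      using \<open>finite U\<close> \<open>finite L\<close> \<open>U \<inter> L = {}\<close> by (rule sum.union_disjoint)
    also have "\<dots> = 0"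
      unfolding U_def L_def sum_upper_covers[OF assms(1) that(2)] sum_lower_covers[OF fin]
      using chi_middle_relation[OF assms(1) that] .
    finally show ?thesis .
  qed
  define I where "I = {R. R \<subseteq> N \<and> card R = d}"
  define X where "X = {T. T \<subseteq> N \<and> card T = Suc d}"
  have fin: "finite I" "finite X" using assms(1) by (auto simp: I_def X_def)
  obtain q where q: "\<And>R. R \<in> I \<Longrightarrow> (\<Sum>T\<in>X. (c T - (\<Sum>Q\<in>I. q Q * e Q T)) * e R T) = 0"
    using orthogonal_projection_exists[OF fin(1), where X = X and f = c and u = e] by blast
  define c' where "c' T = c T - (\<Sum>Q\<in>I. q Q * e Q T)" for T
  have walsh_c': "walsh N c' A = walsh N c A" if "A \<in> middle N" for A
  proof -
    have "walsh N c' A = walsh N c A - (\<Sum>T\<in>Pow N. \<Sum>Q\<in>I. q Q * (e Q T * chi T A))"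
      by (simp add: walsh_def c'_def left_diff_distrib sum_subtractf sum_distrib_right mult.assoc)
    also have "(\<Sum>T\<in>Pow N. \<Sum>Q\<in>I. q Q * (e Q T * chi T A)) = (\<Sum>Q\<in>I. q Q * walsh N (e Q) A)"
      by (subst sum.swap) (simp add: walsh_def sum_distrib_left)
    also have "\<dots> = 0" using e that by (simp add: I_def)
    finally show ?thesis by simp
  qed
  have c'_0: "c' T = 0" if "T \<subseteq> N" "Suc d < card T" for T
    using Suc.prems[OF that] that by (auto simp: c'_def e_def I_def intro!: sum.neutral)
  have c'_top: "(\<Sum>i\<in>N - R. c' (insert i R)) = 0" if "R \<in> I" for R
  proof -
    have R: "R \<subseteq> N" "card R = d" using that by (auto simp: I_def)
    have "0 = (\<Sum>T\<in>X. c' T * e R T)" using q[OF that] by (simp add: c'_def)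
    \<comment> \<open>On the level \<open>X\<close>, \<open>e R\<close> is the indicator of the sets
      covering \<open>R\<close>, so orthogonality to it is exactly the harmonic condition at
      \<open>R\<close>.\<close>
    also have "\<dots> = (\<Sum>T | T \<subseteq> N \<and> R \<subseteq> T \<and> card T = Suc (card R). c' T)"
      using fin R by (intro sum.mono_neutral_cong_right) (auto simp: X_def e_def)
    finally show ?thesis using sum_upper_covers[OF assms(1) R(1), of c'] by simp
  qed
  \<comment> \<open>The relations also reach down to level d - 1, so the lower levels come from
    \<open>c'\<close> and not from \<open>c\<close>.\<close>
  define low where "low T = (if card T \<le> d then c' T else 0)" for T
  have low_0: "low S = 0" if "d < card S" for S
    using that by (simp add: low_def)
  obtain h where h: "harmonic N h" "\<And>S. S \<subseteq> N \<Longrightarrow> d < card S \<Longrightarrow> h S = 0"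
      "\<And>A. A \<in> middle N \<Longrightarrow> walsh N h A = walsh N low A"
    using Suc.IH[of low] low_0 by blast
  define g where "g T = (if card T = Suc d then c' T else h T)" for T
  have "harmonic N g"
    unfolding harmonic_def
  proof (intro allI impI)
    fix R assume R: "R \<subseteq> N"
    then have "finite R" using assms(1) finite_subset by blast
    then have "g (insert i R) = (if card R = d then c' (insert i R) else h (insert i R))"
      if "i \<in> N - R" for i
      using that by (simp add: g_def)
    then show "(\<Sum>i\<in>N - R. g (insert i R)) = 0"
      using c'_top[of R] R h(1) by (cases "card R = d") (simp_all add: I_def harmonic_def)
  qed
  moreover have "g S = 0" if "S \<subseteq> N" "Suc d < card S" for S
    using that h(2) by (simp add: g_def)
  moreover have "walsh N g A = walsh N c A" if A: "A \<in> middle N" for A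
  proof -
    have "walsh N g A - walsh N h A = walsh N c' A - walsh N low A"
      unfolding walsh_def sum_subtractf[symmetric]
      using h(2) c'_0 by (intro sum.cong) (auto simp: g_def low_def not_le less_Suc_eq)
    then show ?thesis using h(3) walsh_c' A by simp
  qed
  ultimately show ?case by blast
qed

section \<open>Hypercontractivity on the middle slice\<close>

text \<open>Expand the square into pairs of levels. By \<open>harmonic_pairing\<close> distinct
  levels are orthogonal on the slice, and each level contributes at least the size of the slice
  times its sum of squared coefficients.\<close>

lemma harmonic_norm_le:
  assumes "finite N" "harmonic N g"
  shows "real (card (middle N)) * (\<Sum>S\<in>Pow N. (g S)\<^sup>2) \<le> (\<Sum>A\<in>middle N. (walsh N g A)\<^sup>2)"
proof -
  define M where "M = real (card (middle N))"
  define lev where "lev k = {S \<in> Pow N. card S = k}" for k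
  define b where "b S T = g S * g T * moment N (sym_diff S T)" for S T
  define a where "a k l = (\<Sum>S\<in>lev k. \<Sum>T\<in>lev l. b S T)" for k l
  have levels: "sum F (Pow N) = (\<Sum>k\<le>card N. sum F (lev k))" for F :: "'a set \<Rightarrow> real"
    unfolding lev_def using assms(1) by (intro sum.group[symmetric]) (auto intro: card_mono)
  have a: "if l = k then M * (\<Sum>S\<in>lev k. (g S)\<^sup>2) \<le> a k l else a k l = 0" if "k \<le> l" for k l
  proof -
    have *: "if l = k then M * (g S)\<^sup>2 \<le> (\<Sum>T\<in>lev l. b S T) else (\<Sum>T\<in>lev l. b S T) = 0"
      if S: "S \<in> lev k" for S
    proof -
      have S': "S \<subseteq> N" "card S = k" using S by (auto simp: lev_def)
      obtain \<gamma> where \<gamma>: "(\<Sum>T | T \<subseteq> N \<and> card T = l. g T * moment N (sym_diff S T)) = \<gamma> * g S"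
          "if l = card S then M \<le> \<gamma> else \<gamma> = 0"
        using harmonic_pairing[OF assms S'(1), of l] S' \<open>k \<le> l\<close> unfolding M_def by blast
      have "(\<Sum>T\<in>lev l. b S T) = g S * (\<Sum>T | T \<subseteq> N \<and> card T = l. g T * moment N (sym_diff S T))"
        by (simp add: lev_def b_def sum_distrib_left mult.assoc)
      also have "\<dots> = \<gamma> * (g S)\<^sup>2" by (simp add: \<gamma>(1) power2_eq_square)
      finally show ?thesis using \<gamma>(2) S' by (auto intro!: mult_right_mono)
    qed
    show ?thesis
      using * by (auto simp: a_def sum_distrib_left intro!: sum_mono)
  qed
  \<comment> \<open>\<open>harmonic_pairing\<close> covers only k <= l; the symmetry of
    \<open>b\<close> supplies the other half.\<close>
  have "b S T = b T S" for S T by (simp add: b_def Un_commute mult.commute)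
  then have "a k l = a l k" for k l
    unfolding a_def by (subst sum.swap) simp
  with a have off: "a k l = 0" if "k \<noteq> l" for k l
    using that by (metis nle_le)
  have "(\<Sum>A\<in>middle N. (walsh N g A)\<^sup>2) = (\<Sum>A\<in>middle N. \<Sum>S\<in>Pow N. \<Sum>T\<in>Pow N. g S * g T * chi (sym_diff S T) A)"
    unfolding walsh_def power2_eq_square sum_product
    using assms(1) by (intro sum.cong refl) (auto simp: mult_ac finite_subset simp flip: chi_mult)
  also have "\<dots> = (\<Sum>S\<in>Pow N. \<Sum>T\<in>Pow N. b S T)"
    by (simp add: b_def moment_def sum_distrib_left sum.swap[of _ _ "middle N"])
  also have "\<dots> = (\<Sum>k\<le>card N. \<Sum>l\<le>card N. a k l)"
    unfolding a_def by (simp add: levels sum.swap[of _ "lev _" "{..card N}"])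
  also have "\<dots> = (\<Sum>k\<le>card N. a k k)"
    using off by (intro sum.cong refl) (simp add: sum.remove[of "{..card N}"])
  also have "\<dots> \<ge> (\<Sum>k\<le>card N. M * (\<Sum>S\<in>lev k. (g S)\<^sup>2))"
    using a by (intro sum_mono) (metis order_refl)
  also have "(\<Sum>k\<le>card N. M * (\<Sum>S\<in>lev k. (g S)\<^sup>2)) = M * (\<Sum>S\<in>Pow N. (g S)\<^sup>2)"
    by (simp add: levels sum_distrib_left)
  finally show ?thesis by (simp add: M_def)
qed

text \<open>Pass to a harmonic g with the same values on the slice. The noise bound carries its
  fourth moment to the cube, Bonami bounds it there by coefficients, and
  \<open>harmonic_norm_le\<close> returns these to the slice.\<close>

lemma middle_hypercontractive:
  fixes c :: "'a set \<Rightarrow> real"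
  defines "M \<equiv> \<lambda>N :: 'a set. real (card (middle N))"
  assumes "finite N" "even (card N)" "\<And>S. S \<subseteq> N \<Longrightarrow> d < card S \<Longrightarrow> c S = 0"
  shows "(\<Sum>A\<in>middle N. walsh N c A ^ 4) / M N
    \<le> 3 * (27 / 4) ^ (2 * d) * ((\<Sum>A\<in>middle N. (walsh N c A)\<^sup>2) / M N)\<^sup>2"
proof -
  have M: "0 < M N"
    using assms by (simp add: M_def card_middle)
  obtain g where g: "harmonic N g" "\<And>S. S \<subseteq> N \<Longrightarrow> d < card S \<Longrightarrow> g S = 0"
      "\<And>A. A \<in> middle N \<Longrightarrow> walsh N g A = walsh N c A"
    using harmonic_representative[of N d c] assms by blast
  \<comment> \<open>\<open>h\<close> undoes noise with rho = 2/3. A general rho would give 1 / (1 -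
    rho) times (3 / rho^2)^(2d); this choice gives 3 and 27/4, within 12 d and 9.\<close>
  define h where "h S = (3 / 2) ^ card S * g S" for S
  define G where "G = (\<Sum>S\<in>Pow N. (g S)\<^sup>2)"
  have G: "0 \<le> G" "G \<le> (\<Sum>A\<in>middle N. (walsh N c A)\<^sup>2) / M N"
    using harmonic_norm_le[OF assms(2) g(1)] M g(3)
    by (auto simp: G_def M_def field_simps intro!: sum_nonneg)
  have "(\<Sum>S\<in>Pow N. 3 ^ card S * (h S)\<^sup>2) \<le> (\<Sum>S\<in>Pow N. (27 / 4) ^ d * (g S)\<^sup>2)"
  proof (rule sum_mono)
    fix S assume S: "S \<in> Pow N"
    have "((3 / 2 :: real) ^ card S)\<^sup>2 = ((3 / 2)\<^sup>2) ^ card S"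
      by (metis power_mult mult.commute)
    then have "3 ^ card S * (h S)\<^sup>2 = (3 * (3 / 2)\<^sup>2) ^ card S * (g S)\<^sup>2"
      unfolding h_def power_mult_distrib by simp
    also have "\<dots> = (27 / 4) ^ card S * (g S)\<^sup>2"
      by (simp add: power2_eq_square)
    also have "\<dots> \<le> (27 / 4) ^ d * (g S)\<^sup>2"
      using S g(2)[of S] by (cases "card S \<le> d") (auto intro!: mult_right_mono power_increasing)
    finally show "3 ^ card S * (h S)\<^sup>2 \<le> (27 / 4) ^ d * (g S)\<^sup>2" .
  qed
  then have "(\<Sum>S\<in>Pow N. 3 ^ card S * (h S)\<^sup>2)\<^sup>2 \<le> ((27 / 4) ^ d * G)\<^sup>2"
    by (intro power_mono) (auto simp: G_def sum_distrib_left intro!: sum_nonneg)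
  with bonami[OF assms(2), of h]
  have cube: "(\<Sum>A\<in>Pow N. walsh N h A ^ 4) \<le> 2 ^ card N * ((27 / 4) ^ d * G)\<^sup>2"
    by (meson mult_left_mono order_trans zero_le_numeral zero_le_power)
  have "(2 / 3) ^ card S * h S = g S" for S
    by (simp add: h_def flip: mult.assoc power_mult_distrib)
  then have "(\<Sum>A\<in>middle N. walsh N c A ^ 4)
      = (\<Sum>A\<in>middle N. walsh N (\<lambda>S. (2 / 3) ^ card S * h S) A ^ 4)"
    using g(3) by simp
  also have "\<dots> \<le> M N / 2 ^ card N / (1 - 2 / 3) * (\<Sum>A\<in>Pow N. walsh N h A ^ 4)"
    unfolding M_def using assms by (intro sum_middle_noise_power4_le) auto
  also have "\<dots> \<le> M N / 2 ^ card N / (1 - 2 / 3) * (2 ^ card N * ((27 / 4) ^ d * G)\<^sup>2)"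
    using M by (intro mult_left_mono cube) auto
  also have "\<dots> = M N * (3 * (27 / 4) ^ (2 * d) * G\<^sup>2)"
    by (simp add: power_mult_distrib mult.commute[of 2 d] flip: power_mult)
  finally have "(\<Sum>A\<in>middle N. walsh N c A ^ 4) / M N \<le> 3 * (27 / 4) ^ (2 * d) * G\<^sup>2"
    using M by (simp add: field_simps)
  also have "\<dots> \<le> 3 * (27 / 4) ^ (2 * d) * ((\<Sum>A\<in>middle N. (walsh N c A)\<^sup>2) / M N)\<^sup>2"
    using G by (intro mult_left_mono power_mono) auto
  finally show ?thesis .
qed


section \<open>Transfer to real polynomials and the uniform distribution\<close>

text \<open>The restriction gives \<open>undefined\<close> outside \<open>{1..n}\<close>, as
  membership in \<open>balanced_slice\<close> demands.\<close>

definition cube_point :: "nat \<Rightarrow> nat set \<Rightarrow> nat \<Rightarrow> real" where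
  "cube_point n A = (\<lambda>i\<in>{1..n}. if i \<in> A then 1 else - 1)"

lemma bij_betw_cube_point:
  "bij_betw (cube_point n) (middle {1..n}) (balanced_slice n)"
proof (rule bij_betw_byWitness[where f' = "\<lambda>x. {i \<in> {1..n}. x i = 1}"])
  show "\<forall>A\<in>middle {1..n}. {i \<in> {1..n}. cube_point n A i = 1} = A"
    by (auto simp: middle_def cube_point_def)
  show "\<forall>x\<in>balanced_slice n. cube_point n {i \<in> {1..n}. x i = 1} = x"
    by (auto simp: balanced_slice_def cube_point_def PiE_def Pi_def extensional_def fun_eq_iff)
  show "cube_point n ` middle {1..n} \<subseteq> balanced_slice n"
    using sum_signs_middle[of "{1..n}"]
    by (auto simp: balanced_slice_def cube_point_def split: if_splits)
  show "(\<lambda>x. {i \<in> {1..n}. x i = 1}) ` balanced_slice n \<subseteq> middle {1..n}"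
  proof (intro image_subsetI)
    fix x assume "x \<in> balanced_slice n"
    then have x: "\<And>i. i \<in> {1..n} \<Longrightarrow> x i = 1 \<or> x i = - 1" "(\<Sum>i = 1..n. x i) = 0"
      by (auto simp: balanced_slice_def)
    define A where "A = {i \<in> {1..n}. x i = 1}"
    \<comment> \<open>This form of the signs turns the zero sum into 2 |A| = n.\<close>
    have "x i = 2 * of_bool (i \<in> A) - 1" if "i \<in> {1..n}" for i
      using x(1)[OF that] that by (auto simp: A_def)
    then have "(\<Sum>i = 1..n. x i) = (\<Sum>i = 1..n. 2 * of_bool (i \<in> A) - 1)"
      by (intro sum.cong) auto
    also have "\<dots> = 2 * real (card ({1..n} \<inter> A)) - real n"
      by (simp add: sum_subtractf flip: sum_distrib_left)
    also have "{1..n} \<inter> A = A" by (auto simp: A_def)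
    finally have "2 * card A = n" using x(2) by simp
    then show "A \<in> middle {1..n}" by (auto simp: middle_def A_def)
  qed
qed

lemma expectation_balanced_pmf:
  assumes "even n"
  shows "measure_pmf.expectation (balanced_pmf n) f
    = (\<Sum>A\<in>middle {1..n}. f (cube_point n A)) / real (card (middle {1..n}))"
proof -
  have card: "card (balanced_slice n) = card (middle {1..n})"
    using bij_betw_same_card[OF bij_betw_cube_point] by simp
  also have "\<dots> > 0" using card_middle[of "{1..n}"] assms by simp
  finally have "finite (balanced_slice n)" "balanced_slice n \<noteq> {}"
    by (auto simp: card_gt_0_iff)
  then show ?thesis
    by (simp add: balanced_pmf_def integral_pmf_of_set card
        sum.reindex_bij_betw[OF bij_betw_cube_point, symmetric])
qed

text \<open>For multilinear \<open>p\<close> a monomial is determined by its keys, so the sum has at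
  most one term; as a sum over a fibre it fits \<open>sum.group\<close> directly.\<close>

definition walsh_coeff :: "real_mpoly \<Rightarrow> nat set \<Rightarrow> real" where
  "walsh_coeff p S = (\<Sum>m | m \<in> Poly_Mapping.keys p \<and> Poly_Mapping.keys m = S. Poly_Mapping.lookup p m)"

lemma multilinear_lookup:
  assumes "multilinear p" "m \<in> Poly_Mapping.keys p" "i \<in> Poly_Mapping.keys m"
  shows "Poly_Mapping.lookup m i = 1"
proof -
  have "Poly_Mapping.lookup m i \<le> 1" using assms by (auto simp: multilinear_def)
  moreover have "Poly_Mapping.lookup m i \<noteq> 0" using assms(3) by (simp add: in_keys_iff)
  ultimately show ?thesis by simp
qed

lemma mpoly_eval_cube_point:
  assumes "multilinear p" "mpoly_vars p \<subseteq> {1..n}"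
  shows "mpoly_eval p (cube_point n A) = walsh {1..n} (walsh_coeff p) A"
proof -
  have keys: "Poly_Mapping.keys m \<subseteq> {1..n}" if "m \<in> Poly_Mapping.keys p" for m
    using assms(2) that by (auto simp: mpoly_vars_def)
  have "mpoly_eval p (cube_point n A)
      = (\<Sum>m\<in>Poly_Mapping.keys p. Poly_Mapping.lookup p m * chi (Poly_Mapping.keys m) A)"
    unfolding mpoly_eval_def chi_def
  proof (intro sum.cong prod.cong refl arg_cong2[of _ _ _ _ "(*)"])
    fix m i assume "m \<in> Poly_Mapping.keys p" "i \<in> Poly_Mapping.keys m"
    then show "cube_point n A i ^ Poly_Mapping.lookup m i = (if i \<in> A then 1 else - 1)"
      using keys[of m] multilinear_lookup[OF assms(1)] by (auto simp: cube_point_def)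
  qed
  also have "\<dots> = (\<Sum>S\<in>Pow {1..n}. \<Sum>m | m \<in> Poly_Mapping.keys p \<and> Poly_Mapping.keys m = S.
      Poly_Mapping.lookup p m * chi (Poly_Mapping.keys m) A)"
    using keys by (intro sum.group[symmetric]) auto
  also have "\<dots> = walsh {1..n} (walsh_coeff p) A"
    by (simp add: walsh_def walsh_coeff_def sum_distrib_right)
  finally show ?thesis .
qed

lemma walsh_coeff_degree:
  assumes "multilinear p" "total_degree p < card S"
  shows "walsh_coeff p S = 0"
proof -
  have "card (Poly_Mapping.keys m) \<le> total_degree p" if "m \<in> Poly_Mapping.keys p" for m
  proof -
    have "card (Poly_Mapping.keys m) = monomial_degree m"
      using multilinear_lookup[OF assms(1) that] by (simp add: monomial_degree_def)
    also have "\<dots> \<le> total_degree p"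
      unfolding total_degree_def using that by (intro Max_ge) auto
    finally show ?thesis .
  qed
  then have "{m. m \<in> Poly_Mapping.keys p \<and> Poly_Mapping.keys m = S} = {}"
    using assms(2) by fastforce
  then show ?thesis by (simp only: walsh_coeff_def sum.empty)
qed

theorem corollary4p8:
  fixes d n :: nat and g :: real_mpoly
  assumes "d \<ge> 1"
    and "even n" and "n > 0"
    and "mpoly_vars g \<subseteq> {1..n}"
    and "multilinear g"
    and "total_degree g \<le> d"
  shows "measure_pmf.expectation (balanced_pmf n) (\<lambda>x. (mpoly_eval g x) ^ 4)
           \<le> 12 * real d * 9 ^ (2 * d)
              * (measure_pmf.expectation (balanced_pmf n) (\<lambda>x. (mpoly_eval g x)\<^sup>2))\<^sup>2"
proof -
  let ?E = "measure_pmf.expectation (balanced_pmf n)"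
  have "?E (\<lambda>x. (mpoly_eval g x) ^ 4) \<le> 3 * (27 / 4) ^ (2 * d) * (?E (\<lambda>x. (mpoly_eval g x)\<^sup>2))\<^sup>2"
    unfolding expectation_balanced_pmf[OF \<open>even n\<close>] mpoly_eval_cube_point[OF \<open>multilinear g\<close> assms(4)]
    using assms by (intro middle_hypercontractive) (auto intro: walsh_coeff_degree)
  \<comment> \<open>Here 3 <= 12 d because d >= 1, and 27/4 <= 9.\<close>
  also have "\<dots> \<le> 12 * real d * 9 ^ (2 * d) * (?E (\<lambda>x. (mpoly_eval g x)\<^sup>2))\<^sup>2"
    using \<open>d \<ge> 1\<close> by (intro mult_right_mono mult_mono power_mono) auto
  finally show ?thesis .
qed

end
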